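(* Every matrix weight is completely reducible; that is, every matrix weight $W$ on an interval $(a,b)$ is equivalent to a direct sum $W_1\oplus\cdots\oplus W_d$ (with $d\geq 1$) of irreducible matrix weights.
   Context: A matrix weight of size $N$ on an interval $(a,b)\subseteq\mathbb R$ is an integrable function $W:(a,b)\to\mathrm{Mat}_N(\mathbb C)$ such that $W(x)$ is positive semidefinite for all $x\in(a,b)$, positive definite for almost every $x$, and with finite moments $\int_a^b x^nW(x)\,dx$ of all orders $n\ge 0$. Two matrix weights $W,W'$ of the same size on the same interval are equivalent if there is a nonsingular constant matrix $M$ with $W'(x)=MW(x)M^*$ for all $x$. $W$ is the direct sum $W_1\oplus\cdots\oplus W_j$ of matrix weights if $W(x)$ is the block diagonal matrix with diagonal blocks $W_1(x),\dots,W_j(x)$. A matrix weight is irreducible if it is not equivalent to a direct sum of matrix weights of smaller size. A matrix weight is completely reducible if it is equivalent to a direct sum of irreducible matrix weights. *)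

theory Defs
  imports
    "HOL-Analysis.Interval_Integral"
    "Jordan_Normal_Form.Schur_Decomposition"
begin

text \<open>
  The size of a matrix weight varies inside the definitions below, so matrices are the
  carrier-based ones of Jordan_Normal_Form.  The order on complex numbers is that of
  Complex_Order: a number is nonnegative (positive) iff it is real and nonnegative (positive).
  The number \<open>(A *\<^sub>v v) \<bullet>c v\<close> is the Hermitian form of \<open>A\<close> at \<open>v\<close>.
\<close>

definition pos_semidef_mat :: "nat \<Rightarrow> complex mat \<Rightarrow> bool" where
  "pos_semidef_mat N A \<longleftrightarrow>
     A \<in> carrier_mat N N \<and> mat_adjoint A = A \<and>
     (\<forall>v \<in> carrier_vec N. 0 \<le> (A *\<^sub>v v) \<bullet>c v)"

definition pos_def_mat :: "nat \<Rightarrow> complex mat \<Rightarrow> bool" where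
  "pos_def_mat N A \<longleftrightarrow>
     A \<in> carrier_mat N N \<and> mat_adjoint A = A \<and>
     (\<forall>v \<in> carrier_vec N. v \<noteq> 0\<^sub>v N \<longrightarrow> 0 < (A *\<^sub>v v) \<bullet>c v)"

definition mat_set_integrable :: "nat \<Rightarrow> real set \<Rightarrow> (real \<Rightarrow> complex mat) \<Rightarrow> bool" where
  "mat_set_integrable N S F \<longleftrightarrow>
     (\<forall>i<N. \<forall>j<N. set_integrable lebesgue S (\<lambda>x. F x $$ (i, j)))"

text \<open>
  The endpoints are extended reals because unbounded intervals (Hermite and Laguerre type
  weights) are meant to be included.  A weight is a function on all of the reals, but only its
  values on the interval are ever used.
\<close>

definition matrix_weight :: "ereal \<Rightarrow> ereal \<Rightarrow> nat \<Rightarrow> (real \<Rightarrow> complex mat) \<Rightarrow> bool" where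
  "matrix_weight a b N W \<longleftrightarrow>
     a < b \<and> 1 \<le> N \<and>
     mat_set_integrable N (einterval a b) W \<and>
     (\<forall>x \<in> einterval a b. pos_semidef_mat N (W x)) \<and>
     (AE x in lebesgue. x \<in> einterval a b \<longrightarrow> pos_def_mat N (W x)) \<and>
     (\<forall>n. mat_set_integrable N (einterval a b) (\<lambda>x. complex_of_real (x ^ n) \<cdot>\<^sub>m W x))"

definition equivalent_weights ::
  "ereal \<Rightarrow> ereal \<Rightarrow> nat \<Rightarrow> (real \<Rightarrow> complex mat) \<Rightarrow> (real \<Rightarrow> complex mat) \<Rightarrow> bool" where
  "equivalent_weights a b N W W' \<longleftrightarrow>
     matrix_weight a b N W \<and> matrix_weight a b N W' \<and>
     (\<exists>M \<in> carrier_mat N N. invertible_mat M \<and>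
        (\<forall>x \<in> einterval a b. W' x = M * W x * mat_adjoint M))"

definition direct_sum :: "(real \<Rightarrow> complex mat) list \<Rightarrow> real \<Rightarrow> complex mat" where
  "direct_sum Ws x = diag_block_mat (map (\<lambda>V. V x) Ws)"

definition irreducible_weight :: "ereal \<Rightarrow> ereal \<Rightarrow> nat \<Rightarrow> (real \<Rightarrow> complex mat) \<Rightarrow> bool" where
  "irreducible_weight a b N W \<longleftrightarrow>
     matrix_weight a b N W \<and>
     \<not> (\<exists>Ws. (\<forall>V \<in> set Ws. \<exists>m<N. matrix_weight a b m V) \<and>
             equivalent_weights a b N W (direct_sum Ws))"

definition completely_reducible_weight ::
  "ereal \<Rightarrow> ereal \<Rightarrow> nat \<Rightarrow> (real \<Rightarrow> complex mat) \<Rightarrow> bool" where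
  "completely_reducible_weight a b N W \<longleftrightarrow>
     matrix_weight a b N W \<and>
     (\<exists>Ws. Ws \<noteq> [] \<and> (\<forall>V \<in> set Ws. \<exists>m. irreducible_weight a b m V) \<and>
           equivalent_weights a b N W (direct_sum Ws))"

end

theory Submission
  imports Defs
begin

text \<open>
  Strong induction on the size.  A weight that is not irreducible is congruent to a direct sum of
  strictly smaller weights; each summand is congruent to a direct sum of irreducible weights, and
  the block diagonal matrix of these congruences, multiplied by the first one, is the required
  congruence.
\<close>

section \<open>Conjugate transposes\<close>

lemma mat_adjoint_dim [simp]:
  "dim_row (mat_adjoint A) = dim_col A" "dim_col (mat_adjoint A) = dim_row A"
  by (auto simp: mat_adjoint_def)

lemma mat_adjoint_carrier [simp, intro]:
  "A \<in> carrier_mat n m \<Longrightarrow> mat_adjoint A \<in> carrier_mat m n"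
  by auto

text \<open>\<open>mat_adjoint\<close> is built from a list of conjugated columns; this entrywise
  form is what the adjoint identities below are computed from.\<close>

lemma mat_adjoint_index:
  "i < dim_col A \<Longrightarrow> j < dim_row A \<Longrightarrow> mat_adjoint A $$ (i, j) = conjugate (A $$ (j, i))"
  by (auto simp: mat_adjoint_def mat_of_rows_index)

lemma mat_adjoint_adjoint: "mat_adjoint (mat_adjoint A) = A"
  by (rule eq_matI) (auto simp: mat_adjoint_index)

lemma mat_adjoint_one: "mat_adjoint (1\<^sub>m n) = (1\<^sub>m n :: complex mat)"
  by (rule eq_matI) (auto simp: mat_adjoint_index)

lemma mat_adjoint_mult:
  fixes A B :: "complex mat"
  assumes "A \<in> carrier_mat n m" "B \<in> carrier_mat m k"
  shows "mat_adjoint (A * B) = mat_adjoint B * mat_adjoint A"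
  by (rule eq_matI)
    (use assms in \<open>auto simp: mat_adjoint_index scalar_prod_def mult.commute intro!: sum.cong\<close>)

lemma mat_adjoint_four_block:
  fixes A B :: "complex mat"
  assumes "A \<in> carrier_mat n n" "B \<in> carrier_mat m m"
  shows "mat_adjoint (four_block_mat A (0\<^sub>m n m) (0\<^sub>m m n) B) =
    four_block_mat (mat_adjoint A) (0\<^sub>m n m) (0\<^sub>m m n) (mat_adjoint B)"
  by (rule eq_matI) (use assms in \<open>auto simp: mat_adjoint_index\<close>)

text \<open>Both sides expand to the same double sum, summed in opposite orders. It serves to move
  the outer factor of a congruence across the Hermitian form.\<close>

lemma cscalar_prod_mat_adjoint:
  fixes A :: "complex mat"
  assumes A: "A \<in> carrier_mat n m" and u: "u \<in> carrier_vec m" and v: "v \<in> carrier_vec n"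
  shows "(A *\<^sub>v u) \<bullet>c v = u \<bullet>c (mat_adjoint A *\<^sub>v v)"
proof -
  have "(A *\<^sub>v u) \<bullet>c v = (\<Sum>i<n. \<Sum>j<m. A $$ (i, j) * u $ j * cnj (v $ i))"
    using assms by (auto simp: scalar_prod_def sum_distrib_right atLeast0LessThan intro!: sum.cong)
  also have "\<dots> = (\<Sum>j<m. \<Sum>i<n. A $$ (i, j) * u $ j * cnj (v $ i))"
    by (rule sum.swap)
  also have "\<dots> = u \<bullet>c (mat_adjoint A *\<^sub>v v)"
    using assms
    by (auto simp: scalar_prod_def sum_distrib_left atLeast0LessThan mat_adjoint_index mult_ac
        intro!: sum.cong)
  finally show ?thesis .
qed

section \<open>Invertible matrices and block diagonal matrices\<close>

lemma invertible_matE: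
  fixes M :: "'a :: semiring_1 mat"
  assumes M: "M \<in> carrier_mat n n" and "invertible_mat M"
  obtains B where "B \<in> carrier_mat n n" "M * B = 1\<^sub>m n" "B * M = 1\<^sub>m n"
proof -
  obtain B where B: "M * B = 1\<^sub>m n" "B * M = 1\<^sub>m (dim_row B)"
    using assms by (auto simp: invertible_mat_def inverts_mat_def)
  \<comment> \<open>\<open>inverts_mat\<close> sizes each identity by its left factor, so the shape
    of \<open>B\<close> has to be recovered by counting columns in the two equations.\<close>
  have "dim_col B = n" using arg_cong[OF B(1), of dim_col] by simp
  moreover have "dim_row B = n" using arg_cong[OF B(2), of dim_col] M by simp
  ultimately show ?thesis using that[of B] B by auto
qed

lemma invertible_matI:
  fixes M :: "'a :: semiring_1 mat"
  assumes "M \<in> carrier_mat n n" "B \<in> carrier_mat n n" "M * B = 1\<^sub>m n" "B * M = 1\<^sub>m n"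
  shows "invertible_mat M"
  unfolding invertible_mat_def inverts_mat_def square_mat.simps
  using assms by (intro conjI exI[of _ B]) auto

lemma invertible_mat_one: "invertible_mat (1\<^sub>m n :: 'a :: semiring_1 mat)"
  by (rule invertible_matI[of _ n "1\<^sub>m n"]) auto

lemma invertible_mat_mult:
  fixes K M :: "'a :: semiring_1 mat"
  assumes K: "K \<in> carrier_mat n n" "invertible_mat K" and M: "M \<in> carrier_mat n n" "invertible_mat M"
  shows "invertible_mat (K * M)"
proof -
  obtain C where C: "C \<in> carrier_mat n n" "K * C = 1\<^sub>m n" "C * K = 1\<^sub>m n"
    using invertible_matE[OF K] .
  obtain B where B: "B \<in> carrier_mat n n" "M * B = 1\<^sub>m n" "B * M = 1\<^sub>m n"
    using invertible_matE[OF M] .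
  have "(K * M) * (B * C) = K * ((M * B) * C)"
    using K M B(1) C(1) by (simp add: assoc_mult_mat[of _ n n _ n _ n])
  then have 1: "(K * M) * (B * C) = 1\<^sub>m n" using B C by simp
  have "(B * C) * (K * M) = B * ((C * K) * M)"
    using K M B(1) C(1) by (simp add: assoc_mult_mat[of _ n n _ n _ n])
  then have 2: "(B * C) * (K * M) = 1\<^sub>m n" using B C M by simp
  show ?thesis
    by (rule invertible_matI[OF _ _ 1 2]) (use K M B C in auto)
qed

lemma mult_block_diag:
  fixes A B C D :: "'a :: comm_ring_1 mat"
  assumes "A \<in> carrier_mat n n" "C \<in> carrier_mat n n" "B \<in> carrier_mat m m" "D \<in> carrier_mat m m"
  shows "four_block_mat A (0\<^sub>m n m) (0\<^sub>m m n) B * four_block_mat C (0\<^sub>m n m) (0\<^sub>m m n) D =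
    four_block_mat (A * C) (0\<^sub>m n m) (0\<^sub>m m n) (B * D)"
  using assms by (subst mult_four_block_mat[of _ n n _ m _ m _ _ n _ m]) auto

text \<open>The inverse is block diagonal too, assembled from the inverses of the two
  blocks.\<close>

lemma invertible_mat_block_diag:
  fixes A B :: "'a :: comm_ring_1 mat"
  assumes A: "A \<in> carrier_mat n n" "invertible_mat A" and B: "B \<in> carrier_mat m m" "invertible_mat B"
  shows "invertible_mat (four_block_mat A (0\<^sub>m n m) (0\<^sub>m m n) B)"
proof -
  obtain C where C: "C \<in> carrier_mat n n" "A * C = 1\<^sub>m n" "C * A = 1\<^sub>m n"
    using invertible_matE[OF A] .
  obtain D where D: "D \<in> carrier_mat m m" "B * D = 1\<^sub>m m" "D * B = 1\<^sub>m m"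
    using invertible_matE[OF B] .
  show ?thesis
    by (rule invertible_matI[of _ "n + m" "four_block_mat C (0\<^sub>m n m) (0\<^sub>m m n) D"])
      (use A B C D in \<open>auto simp: mult_block_diag\<close>)
qed

section \<open>Congruence of Hermitian matrices and positivity\<close>

text \<open>The adjoint reverses products, so successive congruences compose to one. This is what
  makes equivalence of weights transitive.\<close>

lemma congruence_trans:
  fixes A K M :: "complex mat"
  assumes "A \<in> carrier_mat n n" "K \<in> carrier_mat n n" "M \<in> carrier_mat n n"
  shows "K * (M * A * mat_adjoint M) * mat_adjoint K = (K * M) * A * mat_adjoint (K * M)"
  using assms
  by (simp add: mat_adjoint_mult[of K n n M n] assoc_mult_mat[of _ n n _ n _ n]
      mult_carrier_mat[of _ n n _ n])

text \<open>The left factor \<open>M\<close> crosses the Hermitian form as its adjoint, which turns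
  positivity at \<open>v\<close> into positivity of \<open>A\<close> at
  \<open>mat_adjoint M *\<^sub>v v\<close>.\<close>

lemma congruence_form:
  fixes A M :: "complex mat"
  assumes A: "A \<in> carrier_mat n n" and M: "M \<in> carrier_mat n n" and v: "v \<in> carrier_vec n"
  shows "((M * A * mat_adjoint M) *\<^sub>v v) \<bullet>c v
    = (A *\<^sub>v (mat_adjoint M *\<^sub>v v)) \<bullet>c (mat_adjoint M *\<^sub>v v)"
proof -
  have u: "mat_adjoint M *\<^sub>v v \<in> carrier_vec n"
    by (rule mult_mat_vec_carrier) (use M v in auto)
  have "(M * A * mat_adjoint M) *\<^sub>v v = M *\<^sub>v (A *\<^sub>v (mat_adjoint M *\<^sub>v v))"
    using assms u by (simp add: assoc_mult_mat_vec[of _ n n _ n])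
  then show ?thesis
    using cscalar_prod_mat_adjoint[OF M mult_mat_vec_carrier[OF A u] v] by simp
qed

lemma congruence_hermitian:
  fixes A M :: "complex mat"
  assumes "A \<in> carrier_mat n n" "M \<in> carrier_mat n n" "mat_adjoint A = A"
  shows "mat_adjoint (M * A * mat_adjoint M) = M * A * mat_adjoint M"
  using assms
  by (simp add: mat_adjoint_mult[of _ n n _ n] mat_adjoint_adjoint assoc_mult_mat[of _ n n _ n _ n])

lemma pos_semidef_mat_congruence:
  assumes "pos_semidef_mat n A" and M: "M \<in> carrier_mat n n"
  shows "pos_semidef_mat n (M * A * mat_adjoint M)"
proof -
  have "mat_adjoint M *\<^sub>v v \<in> carrier_vec n" if "v \<in> carrier_vec n" for v
    by (rule mult_mat_vec_carrier) (use M that in auto)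
  then show ?thesis
    using assms by (auto simp: pos_semidef_mat_def congruence_form congruence_hermitian)
qed

lemma pos_def_mat_congruence:
  assumes A: "pos_def_mat n A" and M: "M \<in> carrier_mat n n" "invertible_mat M"
  shows "pos_def_mat n (M * A * mat_adjoint M)"
proof -
  obtain B where B: "B \<in> carrier_mat n n" "M * B = 1\<^sub>m n"
    using invertible_matE[OF M] by blast
  \<comment> \<open>The adjoint of a right inverse of \<open>M\<close> is a left inverse of
    \<open>mat_adjoint M\<close>; hence \<open>mat_adjoint M\<close> kills no nonzero vector, and
    strict positivity survives.\<close>
  have BM: "mat_adjoint B * mat_adjoint M = 1\<^sub>m n"
    using mat_adjoint_mult[OF M(1) B(1)] B(2) by (simp add: mat_adjoint_one)
  have car: "mat_adjoint M *\<^sub>v v \<in> carrier_vec n" if "v \<in> carrier_vec n" for v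
    by (rule mult_mat_vec_carrier) (use M that in auto)
  have "mat_adjoint M *\<^sub>v v \<noteq> 0\<^sub>v n" if v: "v \<in> carrier_vec n" "v \<noteq> 0\<^sub>v n" for v
  proof
    assume "mat_adjoint M *\<^sub>v v = 0\<^sub>v n"
    then have "(mat_adjoint B * mat_adjoint M) *\<^sub>v v = mat_adjoint B *\<^sub>v 0\<^sub>v n"
      using M(1) B(1) v(1) by (simp add: assoc_mult_mat_vec[of _ n n _ n])
    also have "\<dots> = 0\<^sub>v n"
      using B(1) by auto
    finally show False using v by (simp add: BM)
  qed
  then show ?thesis
    using A M(1) car by (auto simp: pos_def_mat_def congruence_form congruence_hermitian)
qed

section \<open>Matrix weights under congruence\<close>

lemma mat_set_integrable_cong:
  assumes "\<And>x. x \<in> S \<Longrightarrow> F x = G x"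
  shows "mat_set_integrable n S F \<longleftrightarrow> mat_set_integrable n S G"
  unfolding mat_set_integrable_def
  by (intro all_cong1 imp_cong refl set_integrable_cong) (auto simp: assms)

lemma mat_set_integrable_congruence:
  assumes F: "mat_set_integrable n S F" and car: "\<And>x. x \<in> S \<Longrightarrow> F x \<in> carrier_mat n n"
    and M: "M \<in> carrier_mat n n"
  shows "mat_set_integrable n S (\<lambda>x. M * F x * mat_adjoint M)"
  unfolding mat_set_integrable_def
proof (intro allI impI)
  fix i j assume ij: "i < n" "j < n"
  \<comment> \<open>Each entry of the congruent matrix is a finite linear combination of entries of
    \<open>F x\<close> with constant coefficients.\<close>
  let ?g = "\<lambda>x. \<Sum>l<n. \<Sum>k<n. M $$ (i, k) * F x $$ (k, l) * cnj (M $$ (j, l))"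
  have "set_integrable lebesgue S (\<lambda>x. M $$ (i, k) * F x $$ (k, l) * cnj (M $$ (j, l)))"
    if "k < n" "l < n" for k l
    using F that by (auto simp: mat_set_integrable_def)
  then have "set_integrable lebesgue S ?g"
    unfolding set_integrable_def scaleR_sum_right by (intro Bochner_Integration.integrable_sum) auto
  moreover have "(M * F x * mat_adjoint M) $$ (i, j) = ?g x" if "x \<in> S" for x
    using car[OF that] M ij
    by (auto simp: scalar_prod_def sum_distrib_right atLeast0LessThan mat_adjoint_index
        intro!: sum.cong)
  ultimately show "set_integrable lebesgue S (\<lambda>x. (M * F x * mat_adjoint M) $$ (i, j))"
    by (subst set_integrable_cong[OF refl refl]) auto
qed

lemma matrix_weight_carrier:
  "matrix_weight a b n W \<Longrightarrow> x \<in> einterval a b \<Longrightarrow> W x \<in> carrier_mat n n"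
  by (auto simp: matrix_weight_def pos_semidef_mat_def)

lemma matrix_weight_congruence:
  assumes W: "matrix_weight a b n W" and M: "M \<in> carrier_mat n n" "invertible_mat M"
    and W': "\<And>x. x \<in> einterval a b \<Longrightarrow> W' x = M * W x * mat_adjoint M"
  shows "matrix_weight a b n W'"
proof -
  note car = matrix_weight_carrier[OF W]
  have "mat_set_integrable n (einterval a b) W'"
    using mat_set_integrable_congruence[OF _ car M(1)] W
    by (subst mat_set_integrable_cong[OF W']) (auto simp: matrix_weight_def)
  moreover have "mat_set_integrable n (einterval a b) (\<lambda>x. complex_of_real (x ^ k) \<cdot>\<^sub>m W' x)" for k
  proof -
    \<comment> \<open>The scalar passes through the constant matrices, so the integrand of the
      moment of \<open>W'\<close> is the congruence of the one of \<open>W\<close>.\<close>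
    have "complex_of_real (x ^ k) \<cdot>\<^sub>m W' x
        = M * (complex_of_real (x ^ k) \<cdot>\<^sub>m W x) * mat_adjoint M" if "x \<in> einterval a b" for x
      using M(1) car[OF that] W'[OF that]
      by (simp add: mult_smult_distrib[of _ n n _ n] mult_smult_assoc_mat[of _ n n _ n])
    moreover have "mat_set_integrable n (einterval a b)
        (\<lambda>x. M * (complex_of_real (x ^ k) \<cdot>\<^sub>m W x) * mat_adjoint M)"
      by (rule mat_set_integrable_congruence) (use W car M(1) in \<open>auto simp: matrix_weight_def\<close>)
    ultimately show ?thesis
      by (subst mat_set_integrable_cong) auto
  qed
  moreover have "\<forall>x \<in> einterval a b. pos_semidef_mat n (W' x)"
    using W M(1) W' pos_semidef_mat_congruence by (auto simp: matrix_weight_def)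
  moreover have "AE x in lebesgue. x \<in> einterval a b \<longrightarrow> pos_def_mat n (W' x)"
  proof -
    have "AE x in lebesgue. x \<in> einterval a b \<longrightarrow> pos_def_mat n (W x)"
      using W by (simp add: matrix_weight_def)
    then show ?thesis
      by eventually_elim (use M W' pos_def_mat_congruence in auto)
  qed
  ultimately show ?thesis
    using W by (simp add: matrix_weight_def)
qed

text \<open>\<open>equivalent_weights\<close> asks both functions to be weights; for the second one
  this follows from the congruence.\<close>

lemma equivalent_weightsI:
  assumes "matrix_weight a b n W" "M \<in> carrier_mat n n" "invertible_mat M"
    and "\<And>x. x \<in> einterval a b \<Longrightarrow> W' x = M * W x * mat_adjoint M"
  shows "equivalent_weights a b n W W'"
  using assms matrix_weight_congruence[OF assms] by (auto simp: equivalent_weights_def)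

section \<open>Direct sums of weights\<close>

lemma direct_sum_Nil: "direct_sum [] x = 0\<^sub>m 0 0"
  by (simp add: direct_sum_def)

text \<open>\<open>diag_block_mat\<close> takes the shapes of its zero blocks from the diagonal
  blocks; the carrier assumptions replace these by fixed \<open>n\<close> and \<open>m\<close>, as
  block multiplication requires.\<close>

lemma direct_sum_append:
  assumes "direct_sum Us x \<in> carrier_mat n n" "direct_sum Vs x \<in> carrier_mat m m"
  shows "direct_sum (Us @ Vs) x =
    four_block_mat (direct_sum Us x) (0\<^sub>m n m) (0\<^sub>m m n) (direct_sum Vs x)"
  using assms by (auto simp: direct_sum_def diag_block_mat_append Let_def)

lemma direct_sum_single: "direct_sum [V] x = V x"
  by (simp add: direct_sum_def Let_def) (rule eq_matI, auto)

lemma direct_sum_Cons: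
  assumes "V x \<in> carrier_mat n n" "direct_sum Vs x \<in> carrier_mat m m"
  shows "direct_sum (V # Vs) x = four_block_mat (V x) (0\<^sub>m n m) (0\<^sub>m m n) (direct_sum Vs x)"
  using direct_sum_append[of "[V]" x n Vs m] assms by (simp add: direct_sum_single)

text \<open>By induction on the list, the congruences of the summands are collected in one block
  diagonal matrix. The conclusion is a bare congruence rather than
  \<open>equivalent_weights\<close>, so that the induction can start from the empty list, whose
  direct sum has size 0 and is no weight. The total size \<open>n\<close> is existential because a
  list of functions does not record sizes.\<close>

lemma direct_sum_of_completely_reducible:
  assumes "\<And>V. V \<in> set Ws \<Longrightarrow> \<exists>m. completely_reducible_weight a b m V"
  shows "\<exists>Us n M. (\<forall>U \<in> set Us. \<exists>m. irreducible_weight a b m U) \<and>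
    M \<in> carrier_mat n n \<and> invertible_mat M \<and>
    (\<forall>x \<in> einterval a b. direct_sum Ws x \<in> carrier_mat n n \<and>
       direct_sum Us x = M * direct_sum Ws x * mat_adjoint M)"
  using assms
proof (induction Ws)
  case Nil
  show ?case
    by (rule exI[of _ "[]"], rule exI[of _ 0], rule exI[of _ "1\<^sub>m 0"])
      (auto simp: direct_sum_Nil invertible_mat_one intro!: eq_matI)
next
  case (Cons V Ws)
  obtain Us m K where Us: "\<forall>U \<in> set Us. \<exists>m. irreducible_weight a b m U"
    and K: "K \<in> carrier_mat m m" "invertible_mat K"
    and sumWs: "\<And>x. x \<in> einterval a b \<Longrightarrow> direct_sum Ws x \<in> carrier_mat m m"
    and sumUs: "\<And>x. x \<in> einterval a b \<Longrightarrow>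
      direct_sum Us x = K * direct_sum Ws x * mat_adjoint K"
    using Cons.IH Cons.prems by (metis list.set_intros(2))
  obtain n where "completely_reducible_weight a b n V"
    using Cons.prems by auto
  then obtain Vs M where V: "matrix_weight a b n V"
    and Vs: "\<forall>U \<in> set Vs. \<exists>m. irreducible_weight a b m U"
    and M: "M \<in> carrier_mat n n" "invertible_mat M"
    and sumVs: "\<And>x. x \<in> einterval a b \<Longrightarrow> direct_sum Vs x = M * V x * mat_adjoint M"
    unfolding completely_reducible_weight_def equivalent_weights_def by blast
  \<comment> \<open>The head is decomposed by \<open>M\<close> and the tail by \<open>K\<close>;
    since the adjoint of \<open>?L\<close> is again block diagonal, the triple product splits into
    the two congruences.\<close>
  let ?L = "four_block_mat M (0\<^sub>m n m) (0\<^sub>m m n) K"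
  have "direct_sum (V # Ws) x \<in> carrier_mat (n + m) (n + m) \<and>
      direct_sum (Vs @ Us) x = ?L * direct_sum (V # Ws) x * mat_adjoint ?L"
    if x: "x \<in> einterval a b" for x
  proof -
    have Vx: "V x \<in> carrier_mat n n"
      using matrix_weight_carrier[OF V x] .
    have "direct_sum Vs x \<in> carrier_mat n n" "direct_sum Us x \<in> carrier_mat m m"
      using sumVs[OF x] sumUs[OF x] sumWs[OF x] Vx M(1) K(1) by auto
    note app = direct_sum_append[OF this]
    note cons = direct_sum_Cons[of V, OF Vx sumWs[OF x]]
    have "M * V x \<in> carrier_mat n n" "K * direct_sum Ws x \<in> carrier_mat m m"
      using M(1) K(1) Vx sumWs[OF x] by auto
    then have "direct_sum (Vs @ Us) x = ?L * direct_sum (V # Ws) x * mat_adjoint ?L"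
      unfolding app cons mat_adjoint_four_block[OF M(1) K(1)] sumVs[OF x] sumUs[OF x]
      using Vx sumWs[OF x] M(1) K(1) by (simp add: mult_block_diag)
    then show ?thesis
      unfolding cons using Vx sumWs[OF x] by simp
  qed
  moreover have "invertible_mat ?L"
    by (rule invertible_mat_block_diag[OF M K])
  moreover have "?L \<in> carrier_mat (n + m) (n + m)"
    using M(1) K(1) by simp
  moreover have "\<forall>U \<in> set (Vs @ Us). \<exists>m. irreducible_weight a b m U"
    using Vs Us by auto
  ultimately show ?case by blast
qed

section \<open>Induction on the size\<close>

theorem mainTheorem2:
  fixes a b :: ereal and N :: nat and W :: "real \<Rightarrow> complex mat"
  assumes "matrix_weight a b N W"
  shows "completely_reducible_weight a b N W"
  using assms
proof (induction N arbitrary: W rule: less_induct)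
  case (less N)
  note W = less.prems
  show ?case
  proof (cases "irreducible_weight a b N W")
    case True
    \<comment> \<open>An irreducible weight is its own decomposition with one summand, through the
      identity matrix.\<close>
    have "equivalent_weights a b N W (direct_sum [W])"
      by (rule equivalent_weightsI[OF W, of "1\<^sub>m N"])
        (use matrix_weight_carrier[OF W] in
          \<open>auto simp: invertible_mat_one direct_sum_single mat_adjoint_one
            left_mult_one_mat[of _ N N] right_mult_one_mat[of _ N N]\<close>)
    then show ?thesis
      using True W unfolding completely_reducible_weight_def by (intro conjI exI[of _ "[W]"]) auto
  next
    case False
    then obtain Ws where Ws: "\<And>V. V \<in> set Ws \<Longrightarrow> \<exists>m<N. matrix_weight a b m V"
      and "equivalent_weights a b N W (direct_sum Ws)"
      using W unfolding irreducible_weight_def by blast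
    then obtain M where sumWs: "matrix_weight a b N (direct_sum Ws)"
      and M: "M \<in> carrier_mat N N" "invertible_mat M"
      and eqWs: "\<And>x. x \<in> einterval a b \<Longrightarrow> direct_sum Ws x = M * W x * mat_adjoint M"
      unfolding equivalent_weights_def by blast
    have "\<exists>m. completely_reducible_weight a b m V" if "V \<in> set Ws" for V
      using Ws[OF that] less.IH by blast
    then obtain Us n K where Us: "\<forall>U \<in> set Us. \<exists>m. irreducible_weight a b m U"
      and K: "K \<in> carrier_mat n n" "invertible_mat K"
      and carWs: "\<And>x. x \<in> einterval a b \<Longrightarrow> direct_sum Ws x \<in> carrier_mat n n"
      and eqUs: "\<And>x. x \<in> einterval a b \<Longrightarrow>
        direct_sum Us x = K * direct_sum Ws x * mat_adjoint K"
      using direct_sum_of_completely_reducible[of Ws a b] by metis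
    have "a < b" "1 \<le> N"
      using W by (auto simp: matrix_weight_def)
    \<comment> \<open>Sizes are known only pointwise on the interval. Since \<open>a < b\<close>
      there is a point, and the two shapes of \<open>direct_sum Ws x\<close> there identify
      \<open>n\<close> with \<open>N\<close>.\<close>
    obtain x where x: "x \<in> einterval a b"
      using ereal_dense2[OF \<open>a < b\<close>] by (auto simp: einterval_def)
    have "n = N"
      using carWs[OF x] matrix_weight_carrier[OF sumWs x] by auto
    note K = K[unfolded this]
    have "equivalent_weights a b N W (direct_sum Us)"
    \<comment> \<open>\<open>M\<close> carries \<open>W\<close> to the direct sum of smaller weights
      and \<open>K\<close> carries that to the direct sum of irreducible ones.\<close>
    proof (rule equivalent_weightsI[OF W, of "K * M"])
      show "direct_sum Us x = K * M * W x * mat_adjoint (K * M)" if "x \<in> einterval a b" for x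
        using congruence_trans[OF matrix_weight_carrier[OF W that] K(1) M(1)]
        by (simp add: eqUs eqWs that)
    qed (use K M invertible_mat_mult[OF K M] in auto)
    \<comment> \<open>An empty direct sum is the 0 by 0 matrix, whereas the congruent matrix at
      \<open>x\<close> has \<open>N\<close> rows and \<open>1 \<le> N\<close>.\<close>
    moreover have "Us \<noteq> []"
    proof
      assume "Us = []"
      then have "K * direct_sum Ws x * mat_adjoint K = 0\<^sub>m 0 0"
        using eqUs[OF x] by (simp add: direct_sum_Nil)
      then have "dim_row (K * direct_sum Ws x * mat_adjoint K) = 0" by simp
      then show False using K(1) \<open>1 \<le> N\<close> by simp
    qed
    ultimately show ?thesis
      using W Us unfolding completely_reducible_weight_def by blast
  qed
qed

end
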